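(* Let $\Theta:C\setminus\{o\}\to(0,\infty)$ be continuous and positively homogeneous of degree $-q$, let $E$ be a $C$-pseudo-cone, let $\mathbb{A}$ be a $C$-asymptotic set and let $z\in C\setminus\{o\}$. Then: (a) if $q>n$: $\int_{\partial_eE}\Theta\,d\mathcal{H}^{n-1}<\infty$, $V_\Theta(E)<\infty$, $\overline{V}_\Theta(E)=+\infty$, $T_\Theta(\mathbb{A},o)=+\infty$, and $T_\Theta(\mathbb{A},z)<\infty$; (b) if $q=n$: $\int_{\partial_eE}\Theta\,d\mathcal{H}^{n-1}<\infty$, $V_\Theta(E)=+\infty$, $\overline{V}_\Theta(E)=+\infty$, $T_\Theta(\mathbb{A},o)=+\infty$, and $T_\Theta(\mathbb{A},z)<\infty$; (c) if $n-1<q<n$: $\int_{\partial_eE}\Theta\,d\mathcal{H}^{n-1}<\infty$, $V_\Theta(E)=+\infty$, $\overline{V}_\Theta(E)<\infty$, $T_\Theta(\mathbb{A},o)<\infty$, and $T_\Theta(\mathbb{A},z)<\infty$; (d) if $0\le q\le n-1$: $V_\Theta(E)=+\infty$.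
   Context: $C\subset\mathbb{R}^n$ ($n\ge2$) is a pointed closed convex cone with nonempty interior. A $C$-pseudo-cone is a nonempty closed convex set $E$ with $o\notin E$, $\lambda x\in E$ for all $x\in E,\lambda\ge1$, and recession cone $\{x:E+x\subset E\}$ equal to $C$. A $C$-asymptotic set is an unbounded closed convex set $\mathbb{A}\subset C$ with nonempty interior and $o\notin\mathbb{A}$ such that $\lim_{x\in\partial\mathbb{A},|x|\to\infty}d(x,\partial C)=0$. The weight $\Theta$ satisfies $\Theta(tx)=t^{-q}\Theta(x)$ for $t>0$. Weighted volume $V_\Theta(E)=\int_E\Theta\,d\mathcal{H}^n$; weighted co-volume $\overline{V}_\Theta(E)=\int_{C\setminus E}\Theta\,d\mathcal{H}^n$. For a $C$-asymptotic set $\mathbb{A}$ and $z\in C$, the asymptotic weighted co-volume is $T_\Theta(\mathbb{A},z)=\int_{(z+C)\setminus(z+\mathbb{A})}\Theta\,d\mathcal{H}^n$. The effective boundary is $\partial_eE=E\cap\operatorname{cl}(C\setminus E)$; $\int_{\partial_eE}\Theta\,d\mathcal{H}^{n-1}$ is the total mass of the weighted surface area measure of $E$. *)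

theory Defs
  imports "HOL-Analysis.Analysis"
begin

definition pointed_cone_body :: "'a::euclidean_space set \<Rightarrow> bool" where
  "pointed_cone_body C \<longleftrightarrow> convex_cone C \<and> closed C \<and> C \<inter> uminus ` C = {0} \<and> interior C \<noteq> {}"

definition recession_cone :: "'a::real_vector set \<Rightarrow> 'a set" where
  "recession_cone E = {x. (\<lambda>y. y + x) ` E \<subseteq> E}"

definition pseudo_cone :: "'a::euclidean_space set \<Rightarrow> 'a set \<Rightarrow> bool" where
  "pseudo_cone C E \<longleftrightarrow> E \<noteq> {} \<and> closed E \<and> convex E \<and> 0 \<notin> E \<and>
     (\<forall>x\<in>E. \<forall>l::real. l \<ge> 1 \<longrightarrow> l *\<^sub>R x \<in> E) \<and> recession_cone E = C"

definition asymptotic_set :: "'a::euclidean_space set \<Rightarrow> 'a set \<Rightarrow> bool" where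
  "asymptotic_set C A \<longleftrightarrow> \<not> bounded A \<and> closed A \<and> convex A \<and> A \<subseteq> C \<and>
     interior A \<noteq> {} \<and> 0 \<notin> A \<and>
     (\<forall>\<epsilon>>0. \<exists>R. \<forall>x\<in>frontier A. norm x > R \<longrightarrow> infdist x (frontier C) < \<epsilon>)"

definition effective_boundary :: "'a::euclidean_space set \<Rightarrow> 'a set \<Rightarrow> 'a set" where
  "effective_boundary C E = E \<inter> closure (C - E)"

definition hausdorff_const :: "real \<Rightarrow> real" where
  "hausdorff_const s = pi powr (s / 2) / Gamma (s / 2 + 1) / 2 powr s"

definition hausdorff_pre :: "real \<Rightarrow> real \<Rightarrow> 'a::metric_space set \<Rightarrow> ennreal" where
  "hausdorff_pre s \<delta> A = (INF U \<in> {U :: nat \<Rightarrow> 'a set. A \<subseteq> (\<Union>i. U i) \<and>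
        (\<forall>i. bounded (U i) \<and> diameter (U i) \<le> \<delta>)}.
      (\<Sum>i. ennreal (hausdorff_const s * diameter (U i) powr s)))"

definition hausdorff_outer :: "real \<Rightarrow> 'a::metric_space set \<Rightarrow> ennreal" where
  "hausdorff_outer s A = (SUP \<delta> \<in> {0<..}. hausdorff_pre s \<delta> A)"

definition hausdorff_measure :: "real \<Rightarrow> 'a::metric_space measure" where
  "hausdorff_measure s = measure_of UNIV (sets borel) (hausdorff_outer s)"

definition weighted_volume :: "('a::euclidean_space \<Rightarrow> real) \<Rightarrow> 'a set \<Rightarrow> ennreal" where
  "weighted_volume \<Theta> E = (\<integral>\<^sup>+ x. indicator E x * ennreal (\<Theta> x) \<partial>lborel)"

definition weighted_covolume :: "'a::euclidean_space set \<Rightarrow> ('a \<Rightarrow> real) \<Rightarrow> 'a set \<Rightarrow> ennreal" where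
  "weighted_covolume C \<Theta> E = (\<integral>\<^sup>+ x. indicator (C - E) x * ennreal (\<Theta> x) \<partial>lborel)"

definition asymptotic_covolume :: "'a::euclidean_space set \<Rightarrow> ('a \<Rightarrow> real) \<Rightarrow> 'a set \<Rightarrow> 'a \<Rightarrow> ennreal" where
  "asymptotic_covolume C \<Theta> A z =
     (\<integral>\<^sup>+ x. indicator (((+) z ` C) - ((+) z ` A)) x * ennreal (\<Theta> x) \<partial>lborel)"

definition weighted_surface_mass :: "'a::euclidean_space set \<Rightarrow> ('a \<Rightarrow> real) \<Rightarrow> 'a set \<Rightarrow> ennreal" where
  "weighted_surface_mass C \<Theta> E =
     (\<integral>\<^sup>+ x. indicator (effective_boundary C E) x * ennreal (\<Theta> x)
        \<partial>hausdorff_measure (real DIM('a) - 1))"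

end

theory Submission
  imports Defs
begin

text \<open>
  By homogeneity and compactness \<open>\<Theta>(x) \<le> c |x|\<^sup>-\<^sup>q\<close> on the cone, so an integral over a set \<open>T\<close> avoiding a
  neighbourhood of the origin converges as soon as the measure of \<open>T \<inter> B(R)\<close> is \<open>O(R\<^sup>m)\<close> with \<open>m < q\<close>: sum
  over dyadic shells. Here \<open>m = n\<close> for the volume of \<open>E\<close>. The exponent is \<open>m = n - 1\<close> for the effective boundary,
  which is a Lipschitz graph in a direction from the interior of \<open>C\<close>, and for every strip \<open>C - (e + C)\<close>. Both
  co-volumes are integrals over subsets of such strips, since \<open>E\<close> contains \<open>e + C\<close> for each \<open>e \<in> E\<close>, and an
  asymptotic set contains \<open>a + C\<close> for each of its interior points \<open>a\<close>. Near the origin the integral converges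
  for \<open>q < n\<close>. Divergence comes from self-similarity: \<open>C \<inter> B(r)\<close> contains its half and \<open>E\<close> contains its double,
  and passing to these subsets does not decrease the integral if \<open>q \<ge> n\<close> or \<open>q \<le> n\<close>, respectively.
\<close>

subsection \<open>Integrals of functions of power growth\<close>

lemma nn_integral_lborel_affine:
  fixes t :: "'a::euclidean_space" and c :: real
  assumes "c \<noteq> 0" and [measurable]: "f \<in> borel_measurable borel"
  shows "(\<integral>\<^sup>+x. f x \<partial>lborel) = ennreal (\<bar>c\<bar> ^ DIM('a)) * (\<integral>\<^sup>+x. f (t + c *\<^sub>R x) \<partial>lborel)"
proof -
  have "(\<integral>\<^sup>+x. f x \<partial>lborel)
      = (\<integral>\<^sup>+x. f x \<partial>density (distr lborel borel (\<lambda>x. t + c *\<^sub>R x)) (\<lambda>_. ennreal (\<bar>c\<bar> ^ DIM('a))))"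
    using lborel_affine[OF assms(1), of t] by simp
  also have "\<dots> = ennreal (\<bar>c\<bar> ^ DIM('a)) * (\<integral>\<^sup>+x. f (t + c *\<^sub>R x) \<partial>lborel)"
    by (simp add: nn_integral_density nn_integral_distr nn_integral_cmult)
  finally show ?thesis .
qed

text \<open>Every point of T lies in some piece S k, so the integrand is dominated pointwise by the
  sum of the step functions of height a k on S k. Integrating this sum term by term leaves a
  convergent geometric series.\<close>

lemma nn_integral_finite_geometric_cover:
  assumes meas: "\<And>k. S k \<in> sets M" and cover: "T \<subseteq> (\<Union>k::nat. S k)"
    and bd: "\<And>k x. x \<in> S k \<inter> T \<Longrightarrow> f x \<le> a k"
    and em: "\<And>k. ennreal (a k) * emeasure M (S k) \<le> ennreal (d * \<rho> ^ k)"
    and "0 \<le> d" "0 \<le> \<rho>" "\<rho> < 1"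
  shows "(\<integral>\<^sup>+x. indicator T x * ennreal (f x) \<partial>M) < \<infinity>"
proof -
  have "indicator T x * ennreal (f x) \<le> (\<Sum>k. ennreal (a k) * indicator (S k) x)" for x
  proof (cases "x \<in> T")
    case True
    then obtain k where k: "x \<in> S k" using cover by auto
    have "indicator T x * ennreal (f x) \<le> ennreal (a k) * indicator (S k) x"
      using True k bd[of x k] by (auto intro: ennreal_leI)
    also have "\<dots> = (\<Sum>j\<in>{k}. ennreal (a j) * indicator (S j) x)"
      by (simp only: sum.insert[OF finite.emptyI] sum.empty empty_iff not_False_eq_True add_0_right)
    also have "\<dots> \<le> (\<Sum>j. ennreal (a j) * indicator (S j) x)"
      by (rule sum_le_suminf) auto
    finally show ?thesis .
  qed simp
  then have "(\<integral>\<^sup>+x. indicator T x * ennreal (f x) \<partial>M)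
      \<le> (\<integral>\<^sup>+x. (\<Sum>k. ennreal (a k) * indicator (S k) x) \<partial>M)"
    by (intro nn_integral_mono) auto
  also have "\<dots> = (\<Sum>k. ennreal (a k) * emeasure M (S k))"
    using meas by (subst nn_integral_suminf) (auto simp: nn_integral_cmult_indicator)
  also have "\<dots> \<le> (\<Sum>k. ennreal (d * \<rho> ^ k))"
    by (intro suminf_le em) auto
  also have "\<dots> < \<infinity>"
  proof -
    have "summable (\<lambda>k. d * \<rho> ^ k)"
      using assms by (intro summable_mult summable_geometric) auto
    then show ?thesis
      using assms ennreal_suminf_neq_top[of "\<lambda>k. d * \<rho> ^ k"]
      by (metis infinity_ennreal_def mult_nonneg_nonneg top.not_eq_extremum zero_le_power)
  qed
  finally show ?thesis .
qed

text \<open>On the shell between the radii 2^k r and 2^(k+1) r the integrand is at most c (2^k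
  r)^(-q), and the shell has mass at most d (2^(k+1) r)^m. The products form a geometric series with
  ratio 2^(m-q) < 1. The measure M is kept general because both Lebesgue and Hausdorff measure are
  substituted for it.\<close>

lemma nn_integral_far_finite:
  fixes T :: "'a::euclidean_space set"
  assumes M: "sets M = sets borel" and T: "T \<in> sets borel" and r: "r > 0" "T \<inter> ball 0 r = {}"
    and f: "\<And>x. x \<in> T \<Longrightarrow> f x \<le> c * norm x powr (- q)"
    and em: "\<And>R. R > 0 \<Longrightarrow> emeasure M (T \<inter> ball 0 R) \<le> ennreal (d * R powr m)"
    and "0 \<le> c" "0 \<le> d" "0 \<le> m" "m < q"
  shows "(\<integral>\<^sup>+x. indicator T x * ennreal (f x) \<partial>M) < \<infinity>"
proof (rule nn_integral_finite_geometric_cover[where S = "\<lambda>k. T \<inter> (ball 0 (2 ^ Suc k * r) - ball 0 (2 ^ k * r))"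
      and a = "\<lambda>k. c * (2 ^ k * r) powr (- q)"
      and d = "c * d * r powr (m - q) * 2 powr m" and \<rho> = "2 powr (m - q)"])
  show "T \<subseteq> (\<Union>k. T \<inter> (ball 0 (2 ^ Suc k * r) - ball 0 (2 ^ k * r)))"
  proof
    fix x assume x: "x \<in> T"
    then have nx: "norm x \<ge> r" using r by (force simp: disjoint_iff)
    obtain n :: nat where "norm x / r < 2 ^ n"
      using real_arch_pow[of 2] by auto
    then have ex: "norm x < 2 ^ n * r" using r by (simp add: field_simps)
    \<comment> \<open>The least such exponent is positive because |x| >= r, so its predecessor j
      indexes the shell containing x.\<close>
    define k where "k = (LEAST n. norm x < 2 ^ n * r)"
    have k: "norm x < 2 ^ k * r" unfolding k_def by (rule LeastI[of _ n]) (rule ex)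
    then obtain j where j: "k = Suc j" using nx by (cases k) auto
    have "\<not> norm x < 2 ^ j * r" using not_less_Least[of j "\<lambda>n. norm x < 2 ^ n * r"] j k_def by auto
    then show "x \<in> (\<Union>k. T \<inter> (ball 0 (2 ^ Suc k * r) - ball 0 (2 ^ k * r)))"
      using x k j by (auto intro!: exI[of _ j])
  qed
  show "T \<inter> (ball 0 (2 ^ Suc k * r) - ball 0 (2 ^ k * r)) \<in> sets M" for k
    unfolding M using T by auto
  show "f x \<le> c * (2 ^ k * r) powr (- q)"
    if "x \<in> T \<inter> (ball 0 (2 ^ Suc k * r) - ball 0 (2 ^ k * r)) \<inter> T" for k x
  proof -
    have "norm x powr (- q) \<le> (2 ^ k * r) powr (- q)"
      using that r assms by (intro powr_mono2') auto
    then show ?thesis using f[of x] that \<open>0 \<le> c\<close>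
      by (meson IntD1 mult_left_mono order_trans)
  qed
  show "ennreal (c * (2 ^ k * r) powr (- q)) * emeasure M (T \<inter> (ball 0 (2 ^ Suc k * r) - ball 0 (2 ^ k * r)))
    \<le> ennreal (c * d * r powr (m - q) * 2 powr m * (2 powr (m - q)) ^ k)" for k
  proof -
    have "emeasure M (T \<inter> (ball 0 (2 ^ Suc k * r) - ball 0 (2 ^ k * r))) \<le> emeasure M (T \<inter> ball 0 (2 ^ Suc k * r))"
      using T by (intro emeasure_mono) (auto simp: M)
    also have "\<dots> \<le> ennreal (d * (2 ^ Suc k * r) powr m)" using r by (intro em) auto
    finally have "ennreal (c * (2 ^ k * r) powr (- q)) * emeasure M (T \<inter> (ball 0 (2 ^ Suc k * r) - ball 0 (2 ^ k * r)))
      \<le> ennreal (c * (2 ^ k * r) powr (- q)) * ennreal (d * (2 ^ Suc k * r) powr m)"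
      by (rule mult_left_mono) simp
    also have "\<dots> = ennreal (c * (2 ^ k * r) powr (- q) * (d * (2 ^ Suc k * r) powr m))"
      using assms by (subst ennreal_mult) auto
    also have "c * (2 ^ k * r) powr (- q) * (d * (2 ^ Suc k * r) powr m)
      = c * d * r powr (m - q) * 2 powr m * (2 powr (m - q)) ^ k"
      using r by (simp add: powr_mult powr_realpow[symmetric] powr_powr powr_add powr_diff powr_minus field_simps)
    finally show ?thesis .
  qed
  show "2 powr (m - q) < 1" using \<open>m < q\<close> by (simp add: powr_less_one)
qed (use assms in auto)

text \<open>Serves to remove the origin, where the weight is neither bounded nor continuous and its
  value is arbitrary. A single point is a Lebesgue null set.\<close>

lemma nn_integral_indicator_Diff_singleton:
  fixes y :: "'a::euclidean_space"
  shows "(\<integral>\<^sup>+x. indicator (T - {y}) x * g x \<partial>lborel) = (\<integral>\<^sup>+x. indicator T x * (g x :: ennreal) \<partial>lborel)"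
proof (rule nn_integral_cong_AE)
  have "AE x in lborel. x \<noteq> y" by (rule AE_lborel_singleton)
  then show "AE x in lborel. indicator (T - {y}) x * g x = indicator T x * g x"
    by eventually_elim (auto simp: indicator_def)
qed

text \<open>The counterpart of \<open>nn_integral_far_finite\<close> for shells shrinking to the
  origin. The shell between r / 2^(k+1) and r / 2^k has volume of order 2^(-kn) and the integrand
  there is of order 2^(kq), so the ratio is 2^(q-n) < 1.\<close>

lemma nn_integral_near_finite:
  fixes T :: "'a::euclidean_space set"
  assumes r: "r > 0" "T \<subseteq> ball 0 r"
    and f: "\<And>x. x \<in> T - {0} \<Longrightarrow> f x \<le> c * norm x powr (- q)"
    and "0 \<le> c" "0 \<le> q" "q < real DIM('a)"
  shows "(\<integral>\<^sup>+x. indicator T x * ennreal (f x) \<partial>lborel) < \<infinity>"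
proof -
  let ?n = "DIM('a)"
  have "(\<integral>\<^sup>+x. indicator T x * ennreal (f x) \<partial>lborel) = (\<integral>\<^sup>+x. indicator (T - {0}) x * ennreal (f x) \<partial>lborel)"
    by (rule nn_integral_indicator_Diff_singleton[symmetric])
  also have "\<dots> < \<infinity>"
  proof (rule nn_integral_finite_geometric_cover[where S = "\<lambda>k. ball 0 (r / 2 ^ k) - ball 0 (r / 2 ^ Suc k)"
      and a = "\<lambda>k. c * (r / 2 ^ Suc k) powr (- q)"
      and d = "c * unit_ball_vol ?n * r powr (?n - q) * 2 powr q" and \<rho> = "2 powr (q - ?n)"])
    show "T - {0} \<subseteq> (\<Union>k. ball 0 (r / 2 ^ k) - ball 0 (r / 2 ^ Suc k))"
    proof
      fix x assume x: "x \<in> T - {0}"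
      then have nx: "norm x < r" using r by force
      obtain n :: nat where "r / norm x < 2 ^ n"
        using real_arch_pow[of 2] by auto
      then have ex: "\<not> norm x < r / 2 ^ n" using r x by (simp add: field_simps)
      define k where "k = (LEAST n. \<not> norm x < r / 2 ^ n)"
      have k: "\<not> norm x < r / 2 ^ k" unfolding k_def by (rule LeastI[of _ n]) (rule ex)
      then obtain j where j: "k = Suc j" using nx by (cases k) auto
      have "norm x < r / 2 ^ j" using not_less_Least[of j "\<lambda>n. \<not> norm x < r / 2 ^ n"] j k_def by auto
      then show "x \<in> (\<Union>k. ball 0 (r / 2 ^ k) - ball 0 (r / 2 ^ Suc k))"
        using x k j by (auto intro!: exI[of _ j])
    qed
    show "f x \<le> c * (r / 2 ^ Suc k) powr (- q)"
      if "x \<in> (ball 0 (r / 2 ^ k) - ball 0 (r / 2 ^ Suc k)) \<inter> (T - {0})" for k x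
    proof -
      have "norm x powr (- q) \<le> (r / 2 ^ Suc k) powr (- q)"
        using that r assms by (intro powr_mono2') auto
      then show ?thesis using f[of x] that \<open>0 \<le> c\<close>
        by (meson IntD2 mult_left_mono order_trans)
    qed
    show "ennreal (c * (r / 2 ^ Suc k) powr (- q)) * emeasure lborel (ball (0::'a) (r / 2 ^ k) - ball 0 (r / 2 ^ Suc k))
      \<le> ennreal (c * unit_ball_vol ?n * r powr (?n - q) * 2 powr q * (2 powr (q - ?n)) ^ k)" for k
    proof -
      have "emeasure lborel (ball (0::'a) (r / 2 ^ k) - ball 0 (r / 2 ^ Suc k)) \<le> emeasure lborel (ball (0::'a) (r / 2 ^ k))"
        by (intro emeasure_mono) auto
      also have "\<dots> = ennreal (unit_ball_vol ?n * (r / 2 ^ k) ^ ?n)" using r by (subst emeasure_ball) auto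
      finally have "ennreal (c * (r / 2 ^ Suc k) powr (- q)) * emeasure lborel (ball (0::'a) (r / 2 ^ k) - ball 0 (r / 2 ^ Suc k))
        \<le> ennreal (c * (r / 2 ^ Suc k) powr (- q)) * ennreal (unit_ball_vol ?n * (r / 2 ^ k) ^ ?n)"
        by (rule mult_left_mono) simp
      also have "\<dots> = ennreal (c * (r / 2 ^ Suc k) powr (- q) * (unit_ball_vol ?n * (r / 2 ^ k) ^ ?n))"
        using assms by (subst ennreal_mult) auto
      also have "c * (r / 2 ^ Suc k) powr (- q) * (unit_ball_vol ?n * (r / 2 ^ k) ^ ?n)
        = c * unit_ball_vol ?n * r powr (?n - q) * 2 powr q * (2 powr (q - ?n)) ^ k"
      proof -
        have "(r / 2 ^ k) ^ ?n = (r / 2 ^ k) powr ?n" using r by (simp add: powr_realpow)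
        then show ?thesis using r
          by (simp add: powr_mult powr_divide powr_realpow[symmetric] powr_powr powr_add powr_diff powr_minus field_simps)
      qed
      finally show ?thesis .
    qed
    show "2 powr (q - real ?n) < 1" using assms by (simp add: powr_less_one)
  qed (use assms in auto)
  finally show ?thesis .
qed

text \<open>
  If the integral over \<open>S\<close> were finite, then the integral over \<open>c S \<subseteq> S\<close>, which by homogeneity is at
  least as large, would leave nothing for the part of \<open>S\<close> outside \<open>c S\<close>.
\<close>
lemma nn_integral_self_similar_infinite:
  fixes S :: "'a::euclidean_space set" and f :: "'a \<Rightarrow> real" and c q :: real
  assumes c: "c > 0" and sub: "(\<lambda>x. c *\<^sub>R x) ` S \<subseteq> S"
    and S: "S \<in> sets borel" and meas: "(\<lambda>x. indicator S x * f x) \<in> borel_measurable borel"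
    and pos: "\<And>x. x \<in> S \<Longrightarrow> f x > 0"
    and hom: "\<And>x. x \<in> S \<Longrightarrow> f (c *\<^sub>R x) = c powr (- q) * f x"
    and cq: "c powr (real DIM('a) - q) \<ge> 1"
    and U: "open U" "U \<noteq> {}" "U \<subseteq> S" "U \<inter> (\<lambda>x. c *\<^sub>R x) ` S = {}"
  shows "(\<integral>\<^sup>+x. indicator S x * ennreal (f x) \<partial>lborel) = \<infinity>"
proof (rule ccontr)
  have cancel: "b = 0" if "a + b \<le> a" "a < \<infinity>" for a b :: ennreal
    using that ennreal_add_left_cancel_le[of a b 0] by auto
  let ?cS = "(\<lambda>x. c *\<^sub>R x) ` S" and ?g = "\<lambda>x. ennreal (indicator S x * f x)"
  let ?I = "\<integral>\<^sup>+x. ?g x \<partial>lborel"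
  note [measurable] = meas S
  have g: "?g x = indicator S x * ennreal (f x)" for x by (auto simp: indicator_def)
  assume "\<not> ?thesis"
  then have fin: "?I < \<infinity>" by (simp add: g top.not_eq_extremum)
  have cS: "x \<in> ?cS \<longleftrightarrow> (1 / c) *\<^sub>R x \<in> S" for x
    using c by (force simp: image_iff intro: bexI[of _ "(1 / c) *\<^sub>R x"])
  have "?cS = (\<lambda>x. (1 / c) *\<^sub>R x) -` S \<inter> space borel" using cS by auto
  also have "\<dots> \<in> sets borel" by measurable
  finally have [measurable]: "?cS \<in> sets borel" .
  have [measurable]: "U \<in> sets borel" using U by auto
  \<comment> \<open>The substitution of c x for x produces the factor c^n and homogeneity the factor
    c^(-q). Their product is at least 1 by \<open>cq\<close>.\<close>
  have "(\<integral>\<^sup>+x. indicator ?cS x * ?g x \<partial>lborel)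
      = ennreal (\<bar>c\<bar> ^ DIM('a)) * (\<integral>\<^sup>+x. indicator ?cS (0 + c *\<^sub>R x) * ?g (0 + c *\<^sub>R x) \<partial>lborel)"
    using c by (intro nn_integral_lborel_affine) auto
  also have "(\<integral>\<^sup>+x. indicator ?cS (0 + c *\<^sub>R x) * ?g (0 + c *\<^sub>R x) \<partial>lborel)
      = (\<integral>\<^sup>+x. ennreal (c powr (- q)) * ?g x \<partial>lborel)"
  proof (rule nn_integral_cong)
    fix x
    show "indicator ?cS (0 + c *\<^sub>R x) * ?g (0 + c *\<^sub>R x) = ennreal (c powr (- q)) * ?g x"
    proof (cases "x \<in> S")
      case True
      then have "c *\<^sub>R x \<in> S" "c *\<^sub>R x \<in> ?cS" using sub by auto
      then show ?thesis using True hom[of x] pos[of x] by (simp add: ennreal_mult)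
    next
      case False
      then have "c *\<^sub>R x \<notin> ?cS" using cS[of "c *\<^sub>R x"] c by simp
      then show ?thesis using False by simp
    qed
  qed
  also have "\<dots> = ennreal (c powr (- q)) * ?I" by (simp add: nn_integral_cmult)
  also have "ennreal (\<bar>c\<bar> ^ DIM('a)) * (ennreal (c powr (- q)) * ?I) = ennreal (c powr (real DIM('a) - q)) * ?I"
  proof -
    have "\<bar>c\<bar> ^ DIM('a) * c powr (- q) = c powr (real DIM('a) - q)"
      using c by (simp add: powr_realpow[symmetric] powr_diff powr_minus divide_inverse)
    then show ?thesis
      by (simp only: mult.assoc[symmetric] ennreal_mult'[symmetric] zero_le_power abs_ge_zero powr_ge_zero)
  qed
  also have "\<dots> \<ge> 1 * ?I" using cq by (intro mult_right_mono) auto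
  finally have big: "(\<integral>\<^sup>+x. indicator ?cS x * ?g x \<partial>lborel) \<ge> ?I" by simp
  have "(\<integral>\<^sup>+x. indicator ?cS x * ?g x \<partial>lborel) + (\<integral>\<^sup>+x. indicator U x * ?g x \<partial>lborel)
      = (\<integral>\<^sup>+x. indicator ?cS x * ?g x + indicator U x * ?g x \<partial>lborel)"
    by (rule nn_integral_add[symmetric]) auto
  also have "\<dots> \<le> ?I"
    using U by (intro nn_integral_mono) (auto simp: indicator_def)
  finally have "?I + (\<integral>\<^sup>+x. indicator U x * ?g x \<partial>lborel) \<le> ?I"
    using big by (meson add_right_mono order_trans)
  then have "(\<integral>\<^sup>+x. indicator U x * ?g x \<partial>lborel) = 0"
    using fin by (rule cancel)
  then have "AE x in lborel. indicator U x * ?g x = 0"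
    by (subst (asm) nn_integral_0_iff_AE) auto
  then have "AE x in lborel. x \<notin> U"
    by eventually_elim (use U pos in \<open>force simp: indicator_def split: if_splits\<close>)
  then have "emeasure lborel U = 0" by (subst (asm) AE_iff_measurable[of U]) auto
  then show False
    using U open_not_negligible[of U] by (auto simp: negligible_iff_null_sets null_sets_completion_iff null_sets_def)
qed

lemma nn_integral_indicator_mono:
  "S \<subseteq> T \<Longrightarrow> (\<integral>\<^sup>+x. indicator S x * ennreal (f x) \<partial>M) \<le> (\<integral>\<^sup>+x. indicator T x * ennreal (f x) \<partial>M)"
  by (intro nn_integral_mono) (auto simp: indicator_def)

subsection \<open>Cones, pseudo-cones and asymptotic sets\<close>

lemma pointed_cone_bodyD:
  assumes "pointed_cone_body C"
  shows pointed_cone_body_add: "x \<in> C \<Longrightarrow> y \<in> C \<Longrightarrow> x + y \<in> C"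
    and pointed_cone_body_scaleR: "0 \<le> c \<Longrightarrow> x \<in> C \<Longrightarrow> c *\<^sub>R x \<in> C"
    and pointed_cone_body_closed: "closed C"
    and pointed_cone_body_zero: "0 \<in> C"
    and pointed_cone_body_pointed: "x \<in> C \<Longrightarrow> - x \<in> C \<Longrightarrow> x = 0"
    and pointed_cone_body_zero_notin_interior: "0 \<notin> interior C"
proof -
  note C = assms[unfolded pointed_cone_body_def]
  show "x \<in> C \<Longrightarrow> y \<in> C \<Longrightarrow> x + y \<in> C" "0 \<le> c \<Longrightarrow> x \<in> C \<Longrightarrow> c *\<^sub>R x \<in> C" "closed C" "0 \<in> C"
    using C by (simp_all add: convex_cone_add convex_cone_scaleR convex_cone_contains_0)
  show pt: "x = 0" if "x \<in> C" "- x \<in> C" for x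
  proof -
    have "x \<in> C \<inter> uminus ` C" using that by (metis IntI image_eqI minus_minus)
    then show ?thesis using C by auto
  qed
  \<comment> \<open>A ball around the origin would contain a nonzero vector together with its
    negative, against pointedness.\<close>
  show "0 \<notin> interior C"
  proof
    assume "0 \<in> interior C"
    then obtain \<epsilon> where \<epsilon>: "\<epsilon> > 0" "ball 0 \<epsilon> \<subseteq> C" by (meson mem_interior)
    obtain b :: 'a where b: "b \<in> Basis" by (meson SOME_Basis)
    have "(\<epsilon> / 2) *\<^sub>R b \<in> C" "- ((\<epsilon> / 2) *\<^sub>R b) \<in> C"
      using \<epsilon> b by (auto intro!: subsetD[OF \<epsilon>(2)])
    from pt[OF this] show False using \<epsilon> b by auto
  qed
qed

lemma emeasure_cone_Int_ball:
  fixes C :: "'a::euclidean_space set"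
  assumes C: "pointed_cone_body C" and "R > 0"
  shows "emeasure lborel (C \<inter> ball 0 R) = ennreal (measure lborel (C \<inter> ball 0 1) * R ^ DIM('a))"
proof -
  have [measurable]: "C \<in> sets borel" using pointed_cone_body_closed[OF C] by simp
  have scale: "R *\<^sub>R x \<in> C \<longleftrightarrow> x \<in> C" for x
    using pointed_cone_body_scaleR[OF C, of R x] pointed_cone_body_scaleR[OF C, of "1 / R" "R *\<^sub>R x"] \<open>R > 0\<close>
    by auto
  have "emeasure lborel (C \<inter> ball 0 R) = (\<integral>\<^sup>+x. indicator (C \<inter> ball 0 R) x \<partial>lborel)"
    by simp
  also have "\<dots> = ennreal (\<bar>R\<bar> ^ DIM('a)) * (\<integral>\<^sup>+x. indicator (C \<inter> ball 0 R) (0 + R *\<^sub>R x) \<partial>lborel)"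
    using \<open>R > 0\<close> by (intro nn_integral_lborel_affine borel_measurable_indicator) auto
  also have "(\<integral>\<^sup>+x. indicator (C \<inter> ball 0 R) (0 + R *\<^sub>R x) \<partial>lborel) = (\<integral>\<^sup>+x. indicator (C \<inter> ball 0 1) x \<partial>lborel)"
    using \<open>R > 0\<close> scale by (intro nn_integral_cong) (auto simp: indicator_def)
  also have "\<dots> = emeasure lborel (C \<inter> ball 0 1)" by simp
  also have "\<dots> = ennreal (measure lborel (C \<inter> ball 0 1))"
  proof (rule emeasure_eq_ennreal_measure)
    have "emeasure lborel (C \<inter> ball 0 1) \<le> emeasure lborel (ball (0::'a) 1)"
      by (intro emeasure_mono) auto
    then show "emeasure lborel (C \<inter> ball 0 1) \<noteq> top"
      using emeasure_lborel_ball_finite[of "0::'a" 1] by (auto simp: top_unique)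
  qed
  also have "ennreal (\<bar>R\<bar> ^ DIM('a)) * \<dots> = ennreal (measure lborel (C \<inter> ball 0 1) * R ^ DIM('a))"
    using \<open>R > 0\<close> by (simp add: ennreal_mult mult.commute)
  finally show ?thesis .
qed

text \<open>
  The volume of the strip \<open>C - (e + C)\<close> grows like a surface area, because \<open>(e + C) \<inter> B(R)\<close>
  contains the translate by \<open>e\<close> of \<open>C \<inter> B(R - |e|)\<close>.
\<close>
lemma emeasure_cone_strip:
  fixes C :: "'a::euclidean_space set"
  assumes C: "pointed_cone_body C" and e: "e \<in> C"
  obtains d where "d \<ge> 0"
    "\<And>R. R > 0 \<Longrightarrow> emeasure lborel ((C - (+) e ` C) \<inter> ball 0 R) \<le> ennreal (d * R powr (real DIM('a) - 1))"
proof
  let ?n = "DIM('a)" and ?v = "measure lborel (C \<inter> ball 0 1)"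
  define d where "d = ?v * (?n * norm e)"
  show "d \<ge> 0" unfolding d_def by simp
  have n: "?n \<ge> 1" by (simp add: DIM_positive Suc_leI)
  have [measurable]: "C \<in> sets borel" using pointed_cone_body_closed[OF C] by simp
  fix R :: real assume R: "R > 0"
  have pw: "R powr (real ?n - 1) = R ^ (?n - 1)"
    using R n powr_realpow[of R "?n - 1"] by (simp add: of_nat_diff)
  have Rn: "R ^ ?n = R ^ (?n - 1) * R" using n by (metis power_minus_mult less_le_trans zero_less_one)
  have tr: "(+) e ` S = (\<lambda>x. x - e) -` S" for S
  proof (rule set_eqI)
    fix x show "x \<in> (+) e ` S \<longleftrightarrow> x \<in> (\<lambda>x. x - e) -` S"
      by (auto simp: image_iff intro!: bexI[of _ "x - e"])
  qed
  have [measurable]: "(+) e ` C \<in> sets borel"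
    using measurable_sets[of "\<lambda>x. x - e" borel borel C] tr by simp
  show "emeasure lborel ((C - (+) e ` C) \<inter> ball 0 R) \<le> ennreal (d * R powr (real ?n - 1))"
  \<comment> \<open>For R <= |e| the whole of C in the ball is small enough, since R^n <= R^(n-1) n
    |e|. Otherwise R - |e| is the positive radius of a ball whose part in C can be translated by
    e.\<close>
  proof (cases "R \<le> norm e")
    case True
    have "emeasure lborel ((C - (+) e ` C) \<inter> ball 0 R) \<le> emeasure lborel (C \<inter> ball 0 R)"
      by (intro emeasure_mono) auto
    also have "\<dots> = ennreal (?v * R ^ ?n)" using R by (intro emeasure_cone_Int_ball[OF C]) auto
    also have "\<dots> \<le> ennreal (d * R powr (real ?n - 1))"
    proof (rule ennreal_leI)
      have "1 * R \<le> real ?n * norm e" using True n R by (intro mult_mono) auto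
      then have "R ^ (?n - 1) * R \<le> R ^ (?n - 1) * (?n * norm e)" using R by (intro mult_left_mono) auto
      then have "?v * (R ^ (?n - 1) * R) \<le> ?v * (R ^ (?n - 1) * (?n * norm e))"
        by (rule mult_left_mono) simp
      then show "?v * R ^ ?n \<le> d * R powr (real ?n - 1)" by (simp add: d_def pw Rn mult_ac)
    qed
    finally show ?thesis .
  next
    case False
    let ?B = "C \<inter> ball 0 (R - norm e)"
    have [measurable]: "(+) e ` ?B \<in> sets borel"
      using measurable_sets[of "\<lambda>x. x - e" borel borel ?B] tr[of ?B] by simp
    have sub: "(+) e ` ?B \<subseteq> C \<inter> ball 0 R"
    proof
      fix y assume "y \<in> (+) e ` ?B"
      then obtain x where x: "y = e + x" "x \<in> C" "norm x < R - norm e" by auto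
      then show "y \<in> C \<inter> ball 0 R"
        using pointed_cone_body_add[OF C e, of x] norm_triangle_ineq[of e x] by auto
    qed
    have "emeasure lborel ((+) e ` ?B) = (\<integral>\<^sup>+x. indicator ((+) e ` ?B) x \<partial>lborel)" by simp
    also have "\<dots> = ennreal (\<bar>1\<bar> ^ ?n) * (\<integral>\<^sup>+x. indicator ((+) e ` ?B) (e + 1 *\<^sub>R x) \<partial>lborel)"
      by (intro nn_integral_lborel_affine) auto
    also have "\<dots> = (\<integral>\<^sup>+x. indicator ?B x \<partial>lborel)"
      by (auto intro!: nn_integral_cong simp: indicator_def image_iff)
    also have "\<dots> = emeasure lborel ?B" by simp
    also have "\<dots> = ennreal (?v * (R - norm e) ^ ?n)"
      using False by (intro emeasure_cone_Int_ball[OF C]) auto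
    finally have eB: "emeasure lborel ((+) e ` ?B) = ennreal (?v * (R - norm e) ^ ?n)" .
    have "emeasure lborel ((C - (+) e ` C) \<inter> ball 0 R) \<le> emeasure lborel ((C \<inter> ball 0 R) - (+) e ` ?B)"
      by (intro emeasure_mono) auto
    also have "\<dots> = emeasure lborel (C \<inter> ball 0 R) - emeasure lborel ((+) e ` ?B)"
      using sub by (intro emeasure_Diff) (auto simp: eB)
    also have "\<dots> = ennreal (?v * R ^ ?n) - ennreal (?v * (R - norm e) ^ ?n)"
      using R by (simp add: eB emeasure_cone_Int_ball[OF C])
    also have "\<dots> = ennreal (?v * R ^ ?n - ?v * (R - norm e) ^ ?n)"
      using False by (intro ennreal_minus) auto
    also have "\<dots> \<le> ennreal (d * R powr (real ?n - 1))"
    proof (rule ennreal_leI)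
      \<comment> \<open>Bernoulli's inequality at -|e| / R >= -1 yields R^n - (R - |e|)^n <= n |e|
        R^(n-1). This is the origin of the factor n |e| in d.\<close>
      have "1 + real ?n * (- norm e / R) \<le> (1 + - norm e / R) ^ ?n"
        using False R by (intro Bernoulli_inequality) (auto simp: field_simps)
      then have "R ^ ?n * (1 - real ?n * norm e / R) \<le> R ^ ?n * (1 - norm e / R) ^ ?n"
        using R by (intro mult_left_mono) auto
      also have "\<dots> = (R - norm e) ^ ?n"
        using R by (simp add: power_mult_distrib[symmetric] right_diff_distrib)
      also have "R ^ ?n * (1 - real ?n * norm e / R) = R ^ ?n - R ^ (?n - 1) * (?n * norm e)"
        using R by (simp add: Rn right_diff_distrib)
      finally have "R ^ ?n - R ^ (?n - 1) * (?n * norm e) \<le> (R - norm e) ^ ?n" .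
      then have "?v * (R ^ ?n - (R - norm e) ^ ?n) \<le> ?v * (R ^ (?n - 1) * (?n * norm e))"
        by (intro mult_left_mono) auto
      then show "?v * R ^ ?n - ?v * (R - norm e) ^ ?n \<le> d * R powr (real ?n - 1)"
        by (simp add: d_def pw algebra_simps)
    qed
    finally show ?thesis .
  qed
qed

lemma homogeneous_upper_bound:
  fixes C :: "'a::euclidean_space set" and f :: "'a \<Rightarrow> real"
  assumes C: "pointed_cone_body C" and cont: "continuous_on (C - {0}) f"
    and hom: "\<forall>x\<in>C - {0}. \<forall>t>0. f (t *\<^sub>R x) = t powr (- q) * f x"
  obtains c where "c \<ge> 0" "\<And>x. x \<in> C - {0} \<Longrightarrow> f x \<le> c * norm x powr (- q)"
proof -
  have "compact (C \<inter> sphere 0 1)"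
    using pointed_cone_body_closed[OF C] by (simp add: closed_Int_compact)
  moreover have "continuous_on (C \<inter> sphere 0 1) f"
    by (rule continuous_on_subset[OF cont]) auto
  ultimately have "bounded (f ` (C \<inter> sphere 0 1))"
    by (intro compact_imp_bounded compact_continuous_image)
  then obtain c where c: "c > 0" "\<And>x. x \<in> C \<inter> sphere 0 1 \<Longrightarrow> \<bar>f x\<bar> \<le> c"
    by (auto simp: bounded_pos)
  have "f x \<le> c * norm x powr (- q)" if x: "x \<in> C - {0}" for x
  proof -
    have u: "x /\<^sub>R norm x \<in> C \<inter> sphere 0 1"
      using x pointed_cone_body_scaleR[OF C, of "inverse (norm x)" x] by auto
    then have u': "x /\<^sub>R norm x \<in> C - {0}" by auto
    have "f x = f (norm x *\<^sub>R (x /\<^sub>R norm x))" using x by simp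
    also have "\<dots> = norm x powr (- q) * f (x /\<^sub>R norm x)"
      using x u' hom by (metis DiffE insertI1 zero_less_norm_iff)
    also have "\<dots> \<le> norm x powr (- q) * c"
      using c(2)[OF u] by (intro mult_left_mono) auto
    finally show ?thesis by (simp add: mult.commute)
  qed
  then show ?thesis using that c by (meson less_imp_le)
qed

text \<open>By pointedness the compact set of unit vectors of C is disjoint from the closed cone -C,
  hence at positive distance \<kappa> from it. Scaling by |c| gives the inequality. It guarantees
  that moving a far away point of C in a direction of C keeps it far away.\<close>

lemma pointed_cone_norm_add_ge:
  fixes C :: "'a::euclidean_space set"
  assumes C: "pointed_cone_body C"
  obtains \<kappa> where "\<kappa> > 0" "\<And>c d. c \<in> C \<Longrightarrow> d \<in> C \<Longrightarrow> norm (c + d) \<ge> \<kappa> * norm c"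
proof -
  have "compact (C \<inter> sphere 0 1)" "closed (uminus ` C)"
    using pointed_cone_body_closed[OF C] by (auto simp: closed_Int_compact closed_negations)
  moreover have "(C \<inter> sphere 0 1) \<inter> uminus ` C = {}"
    using pointed_cone_body_pointed[OF C] by fastforce
  ultimately obtain \<kappa> where \<kappa>: "\<kappa> > 0" "\<And>x y. x \<in> C \<inter> sphere 0 1 \<Longrightarrow> y \<in> uminus ` C \<Longrightarrow> \<kappa> \<le> dist x y"
    by (meson separate_compact_closed)
  have "norm (c + d) \<ge> \<kappa> * norm c" if "c \<in> C" "d \<in> C" for c d
  proof (cases "c = 0")
    case False
    have "c /\<^sub>R norm c \<in> C \<inter> sphere 0 1" "- (d /\<^sub>R norm c) \<in> uminus ` C"
      using that False pointed_cone_body_scaleR[OF C, of "inverse (norm c)"] by auto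
    from \<kappa>(2)[OF this] have "\<kappa> \<le> norm ((c + d) /\<^sub>R norm c)"
      by (simp only: dist_norm diff_minus_eq_add scaleR_right_distrib)
    also have "\<dots> = norm (c + d) / norm c" by (simp add: divide_inverse mult.commute)
    finally show ?thesis using False by (simp add: field_simps)
  qed simp
  then show ?thesis using that \<kappa> by blast
qed

text \<open>Convex combinations of a with points ever further out on the ray, weighted by the
  reciprocal of the distance parameter, converge to a + v. So a direction of one ray in A is a
  recession direction at every point of A.\<close>

lemma closed_convex_ray_translate:
  fixes A :: "'a::euclidean_space set"
  assumes "closed A" "convex A" "a \<in> A" "\<And>t. t \<ge> 0 \<Longrightarrow> p + t *\<^sub>R v \<in> A"
  shows "a + v \<in> A"
proof -
  have "(\<lambda>k. (1 - 1 / real (Suc k)) *\<^sub>R a + (1 / real (Suc k)) *\<^sub>R (p + real (Suc k) *\<^sub>R v)) \<longlonglongrightarrow> (1 - 0) *\<^sub>R a + (0 *\<^sub>R p + v)"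
  proof -
    have eq: "(1 / real (Suc k)) *\<^sub>R (p + real (Suc k) *\<^sub>R v) = (1 / real (Suc k)) *\<^sub>R p + v" for k
      by (simp add: scaleR_right_distrib del: of_nat_Suc)
    have "(\<lambda>k. 1 / real (Suc k)) \<longlonglongrightarrow> 0" using LIMSEQ_inverse_real_of_nat by (simp add: inverse_eq_divide)
    then show ?thesis unfolding eq by (intro tendsto_intros)
  qed
  moreover have "(1 - 1 / real (Suc k)) *\<^sub>R a + (1 / real (Suc k)) *\<^sub>R (p + real (Suc k) *\<^sub>R v) \<in> A" for k
    using assms by (intro convexD) auto
  ultimately have "(1 - 0) *\<^sub>R a + (0 *\<^sub>R p + v) \<in> A"
    using assms(1) by (meson closed_sequentially)
  then show ?thesis by simp
qed

text \<open>
  Points of \<open>A\<close> halfway between an inner point \<open>a\<close> and a far away point keep a fixed distance from the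
  boundary of \<open>C\<close>, and so do their translates by \<open>t v\<close>. A ray in direction \<open>v\<close> leaving \<open>A\<close> from such a point
  would hit the frontier of \<open>A\<close> far away, but not close to the boundary of \<open>C\<close>.
\<close>
lemma asymptotic_set_contains_translate:
  fixes C :: "'a::euclidean_space set"
  assumes C: "pointed_cone_body C" and A: "asymptotic_set C A"
  obtains a where "a \<in> C" "(+) a ` C \<subseteq> A"
proof -
  have "interior A \<noteq> {}" using A by (auto simp: asymptotic_set_def)
  then obtain a \<rho> where \<rho>: "\<rho> > 0" "ball a \<rho> \<subseteq> A" by (meson all_not_in_conv mem_interior)
  have AC: "A \<subseteq> C" and clA: "closed A" and coA: "convex A" and unb: "\<not> bounded A"
    using A by (auto simp: asymptotic_set_def)
  have aA: "a \<in> A" using \<rho> by auto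
  have aC: "a \<in> C" using aA AC by auto
  have "\<exists>R. \<forall>x\<in>frontier A. norm x > R \<longrightarrow> infdist x (frontier C) < \<rho> / 2"
    using A half_gt_zero[OF \<rho>(1)] unfolding asymptotic_set_def by blast
  then obtain R where R: "\<And>x. x \<in> frontier A \<Longrightarrow> norm x > R \<Longrightarrow> infdist x (frontier C) < \<rho> / 2"
    by blast
  obtain \<kappa> where \<kappa>: "\<kappa> > 0" "\<And>c d. c \<in> C \<Longrightarrow> d \<in> C \<Longrightarrow> norm (c + d) \<ge> \<kappa> * norm c"
    using pointed_cone_norm_add_ge[OF C] by blast
  \<comment> \<open>The bound is such that the midpoint p of a and b satisfies \<kappa> |p| > R. By
    the choice of \<kappa> every point p + t v with v in C and t >= 0 then has norm above R.\<close>
  obtain b where b: "b \<in> A" "norm b > norm a + 2 * ((\<bar>R\<bar> + 1) / \<kappa>)"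
    using unb unfolding bounded_iff by (meson not_le)
  define p where "p = (1 / 2) *\<^sub>R a + (1 / 2) *\<^sub>R b"
  have pA: "p \<in> A" unfolding p_def using aA b coA by (intro convexD) auto
  have "norm b \<le> norm a + 2 * norm p"
  proof -
    have "b = 2 *\<^sub>R p - a" by (simp add: p_def scaleR_right_distrib)
    then show ?thesis using norm_triangle_ineq4[of "2 *\<^sub>R p" a] by simp
  qed
  then have "norm p > (\<bar>R\<bar> + 1) / \<kappa>" using b(2) by linarith
  then have np: "\<kappa> * norm p > R" using \<kappa>(1) by (simp add: field_simps)
  \<comment> \<open>The frontier has to be nonempty for \<open>infdist\<close> to be attained by one
    of its points.\<close>
  have fr0: "0 \<in> frontier C"
    using pointed_cone_body_zero[OF C] pointed_cone_body_zero_notin_interior[OF C] closure_subset[of C]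
    by (auto simp: frontier_def)
  have ray: "p + t *\<^sub>R v \<in> A" if v: "v \<in> C" and t: "t \<ge> 0" for v t
  proof (rule ccontr)
    assume "p + t *\<^sub>R v \<notin> A"
    then have "closed_segment p (p + t *\<^sub>R v) \<inter> frontier A \<noteq> {}"
      using pA by (intro connected_Int_frontier) (auto simp: disjoint_iff)
    then obtain x where x: "x \<in> frontier A" "x \<in> closed_segment p (p + t *\<^sub>R v)" by auto
    then obtain s where s: "0 \<le> s" "x = p + (s * t) *\<^sub>R v"
      by (auto simp: in_segment algebra_simps)
    have vC: "(s * t) *\<^sub>R v \<in> C" using s t v by (intro pointed_cone_body_scaleR[OF C]) auto
    have "norm x > R" using \<kappa>(2)[OF _ vC, of p] np s pA AC by auto
    then have "infdist x (frontier C) < \<rho> / 2" using R x by auto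
    then obtain y where y: "y \<in> frontier C" "dist x y < \<rho> / 2"
      using fr0 by (metis infdist_attains_inf empty_iff frontier_closed)
    \<comment> \<open>A point w of this ball is half of a point of \<open>ball a \<rho>\<close>,
      plus half of b, plus a multiple of v, and all three summands lie in C. The nearby frontier
      point y would thus be interior to C.\<close>
    have "ball x (\<rho> / 2) \<subseteq> C"
    proof
      fix w assume w: "w \<in> ball x (\<rho> / 2)"
      have "a + 2 *\<^sub>R (w - x) \<in> ball a \<rho>" using w by (simp add: dist_norm norm_minus_commute)
      then have "a + 2 *\<^sub>R (w - x) \<in> C" using \<rho> AC by auto
      then have "(1 / 2) *\<^sub>R (a + 2 *\<^sub>R (w - x)) + ((1 / 2) *\<^sub>R b + (s * t) *\<^sub>R v) \<in> C"
        using vC b AC pointed_cone_body_scaleR[OF C, of "1 / 2"]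
        by (metis pointed_cone_body_add[OF C] subsetD zero_le_divide_1_iff zero_le_numeral)
      moreover have "(1 / 2) *\<^sub>R (a + 2 *\<^sub>R (w - x)) + ((1 / 2) *\<^sub>R b + (s * t) *\<^sub>R v) = w"
        using s by (simp add: p_def scaleR_right_distrib)
      ultimately show "w \<in> C" by simp
    qed
    then have "y \<in> interior C" using y(2) by (auto simp: interior_def)
    then show False using y(1) by (simp add: frontier_def)
  qed
  have "(+) a ` C \<subseteq> A"
    using closed_convex_ray_translate[OF clA coA aA] ray by auto
  then show ?thesis using that aC by blast
qed

lemma pseudo_cone_add:
  assumes "pseudo_cone C E" "x \<in> E" "c \<in> C"
  shows "x + c \<in> E"
  using assms by (auto simp: pseudo_cone_def recession_cone_def)

text \<open>For x in E the dilates (1 + t) x form a ray in E with direction x, so x is a recession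
  direction of E and hence lies in C.\<close>

lemma pseudo_cone_subset:
  fixes C E :: "'a::euclidean_space set"
  assumes "pseudo_cone C E"
  shows "E \<subseteq> C"
proof
  fix x assume x: "x \<in> E"
  note E = assms[unfolded pseudo_cone_def]
  have "y + x \<in> E" if "y \<in> E" for y
  proof (rule closed_convex_ray_translate[of E y x x])
    fix t :: real assume "t \<ge> 0"
    then have "(1 + t) *\<^sub>R x \<in> E" using E x by auto
    then show "x + t *\<^sub>R x \<in> E" by (simp add: scaleR_left_distrib)
  qed (use E that in auto)
  then show "x \<in> C" using E by (auto simp: recession_cone_def)
qed

subsection \<open>Hausdorff measure of the effective boundary\<close>

text \<open>
  \<open>measure_of\<close> returns the zero measure if the outer measure is not countably additive on the Borel sets. The
  upper bound holds in either case, so the Caratheodory construction is not needed.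
\<close>
lemma emeasure_hausdorff_measure_le: "emeasure (hausdorff_measure s) X \<le> hausdorff_outer s X"
  unfolding hausdorff_measure_def by (subst emeasure_measure_of_conv) auto

lemma sets_hausdorff_measure: "sets (hausdorff_measure s) = sets borel"
  unfolding hausdorff_measure_def using sets.sets_measure_of_eq[of borel] by (simp only: space_borel)

lemma hausdorff_const_nonneg: "s \<ge> 0 \<Longrightarrow> hausdorff_const s \<ge> 0"
  unfolding hausdorff_const_def by (simp add: Gamma_real_pos less_imp_le)

text \<open>
  The coordinates \<open>g\<close> are cut into \<open>2 N + 1\<close> intervals each, and the pieces of \<open>X\<close> lying over the resulting
  cells of the grid form the cover.
\<close>
lemma hausdorff_outer_le_of_coordinates:
  fixes X :: "'a::euclidean_space set" and g :: "'i \<Rightarrow> 'a \<Rightarrow> real"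
  assumes I: "finite I" "I \<noteq> {}" and R: "R > 0" and L: "L > 0"
    and bd: "\<And>i x. i \<in> I \<Longrightarrow> x \<in> X \<Longrightarrow> \<bar>g i x\<bar> \<le> R"
    and lip: "\<And>x y. x \<in> X \<Longrightarrow> y \<in> X \<Longrightarrow> norm (x - y) \<le> L * (\<Sum>i\<in>I. \<bar>g i x - g i y\<bar>)"
  shows "hausdorff_outer (real (card I)) X
    \<le> ennreal (hausdorff_const (real (card I)) * (3 * (L * card I * R)) ^ card I)"
  unfolding hausdorff_outer_def
proof (rule SUP_least)
  fix \<delta> :: real assume "\<delta> \<in> {0<..}"
  then have \<delta>: "\<delta> > 0" by simp
  let ?d = "card I" and ?h = "hausdorff_const (real (card I))"
  have d: "?d > 0" using I by (simp add: card_gt_0_iff)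
  define K where "K = L * ?d * R"
  have K: "K > 0" using d L R by (simp add: K_def)
  \<comment> \<open>Within a cell each coordinate varies by at most R / N, so by the Lipschitz bound
    a cell has diameter at most K / N, which this choice makes smaller than \<delta>.\<close>
  obtain N :: nat where N: "N > K / \<delta>" using reals_Archimedean2 by blast
  have N0: "N > 0" using N K \<delta> by (metis divide_pos_pos less_trans of_nat_0_less_iff)
  define cell where "cell \<phi> = {x\<in>X. \<forall>i\<in>I. \<lfloor>g i x * N / R\<rfloor> = \<phi> i}" for \<phi> :: "'i \<Rightarrow> int"
  define J where "J = (\<Pi>\<^sub>E i\<in>I. {- int N..int N})"
  have finJ: "finite J" unfolding J_def using I by (intro finite_PiE) auto
  have cardJ: "card J = (2 * N + 1) ^ ?d"
  proof -
    have "card {- int N..int N} = 2 * N + 1" by simp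
    then show ?thesis unfolding J_def using I by (simp add: card_PiE)
  qed
  obtain e where e: "bij_betw e {0..<card J} J" using ex_bij_betw_nat_finite[OF finJ] by blast
  \<comment> \<open>\<open>hausdorff_pre\<close> asks for a cover indexed by all natural numbers.
    The empty sets added here have diameter 0 and contribute nothing to the sum.\<close>
  define U where "U k = (if k < card J then cell (e k) else {})" for k
  have norm_cell: "norm (x - y) \<le> K / N" if "x \<in> cell \<phi>" "y \<in> cell \<phi>" for x y \<phi>
  proof -
    have "\<bar>g i x - g i y\<bar> \<le> R / N" if i: "i \<in> I" for i
    proof -
      have "\<lfloor>g i x * N / R\<rfloor> = \<lfloor>g i y * N / R\<rfloor>"
        using \<open>x \<in> cell \<phi>\<close> \<open>y \<in> cell \<phi>\<close> i by (simp add: cell_def)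
      then have "\<bar>g i x * N / R - g i y * N / R\<bar> \<le> 1" by linarith
      also have "g i x * N / R - g i y * N / R = (g i x - g i y) * (N / R)"
        by (simp add: left_diff_distrib diff_divide_distrib)
      finally have "\<bar>g i x - g i y\<bar> * (N / R) \<le> 1" unfolding abs_mult using R by simp
      then show ?thesis using R N0 by (simp add: field_simps)
    qed
    then have "(\<Sum>i\<in>I. \<bar>g i x - g i y\<bar>) \<le> ?d * (R / N)" by (intro sum_bounded_above) auto
    then have "L * (\<Sum>i\<in>I. \<bar>g i x - g i y\<bar>) \<le> L * (?d * (R / N))" using L by (intro mult_left_mono) auto
    moreover have "norm (x - y) \<le> L * (\<Sum>i\<in>I. \<bar>g i x - g i y\<bar>)"
      using that by (intro lip) (auto simp: cell_def)
    ultimately show ?thesis by (simp add: K_def mult.assoc)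
  qed
  have normU: "norm (x - y) \<le> K / N" if "x \<in> U k" "y \<in> U k" for x y k
    using that norm_cell by (auto simp: U_def split: if_splits)
  have KN: "K / N \<ge> 0" using K by simp
  have diamU: "diameter (U k) \<le> K / N" for k
    using normU KN by (intro diameter_le) auto
  have bddU: "bounded (U k)" for k
    unfolding bounded_two_points dist_norm using normU by blast
  have XU: "X \<subseteq> (\<Union>k. U k)"
  proof
    fix x assume x: "x \<in> X"
    define \<phi> where "\<phi> = restrict (\<lambda>i. \<lfloor>g i x * N / R\<rfloor>) I"
    have "\<phi> \<in> J" unfolding J_def \<phi>_def
    proof (rule restrict_PiE_iff[THEN iffD2], rule ballI)
      fix i assume i: "i \<in> I"
      have "\<bar>g i x * N / R\<bar> \<le> N"
        using mult_right_mono[OF bd[OF i x], of N] R by (simp add: abs_mult field_simps)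
      then show "\<lfloor>g i x * N / R\<rfloor> \<in> {- int N..int N}"
        unfolding atLeastAtMost_iff by linarith
    qed
    then obtain k where k: "k < card J" "e k = \<phi>"
      using e unfolding bij_betw_def by (metis atLeastLessThan_iff imageE)
    then have "x \<in> U k" using x by (simp add: U_def cell_def \<phi>_def)
    then show "x \<in> (\<Union>k. U k)" by blast
  qed
  have KNd: "K / N \<le> \<delta>" using N N0 \<delta> by (simp add: field_simps)
  have "U \<in> {U. X \<subseteq> (\<Union>i. U i) \<and> (\<forall>i. bounded (U i) \<and> diameter (U i) \<le> \<delta>)}"
    using XU bddU diamU KNd by (auto intro: order_trans)
  then have "hausdorff_pre (real ?d) \<delta> X \<le> (\<Sum>i. ennreal (?h * diameter (U i) powr real ?d))"
    unfolding hausdorff_pre_def by (rule INF_lower)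
  also have "\<dots> = (\<Sum>i<card J. ennreal (?h * diameter (U i) powr real ?d))"
    using d by (intro suminf_finite) (auto simp: U_def)
  also have "\<dots> \<le> (\<Sum>i<card J. ennreal (?h * (K / N) ^ ?d))"
  proof (intro sum_mono ennreal_leI mult_left_mono hausdorff_const_nonneg)
    fix k
    have "diameter (U k) powr real ?d \<le> (K / N) powr real ?d"
      using diamU bddU by (intro powr_mono2 diameter_ge_0) auto
    also have "\<dots> = (K / N) ^ ?d" using K N0 by (simp add: powr_realpow)
    finally show "diameter (U k) powr real ?d \<le> (K / N) ^ ?d" .
  qed simp
  also have "\<dots> = ennreal (card J * (?h * (K / N) ^ ?d))"
    using KN hausdorff_const_nonneg[of ?d] by (simp add: ennreal_mult ennreal_of_nat_eq_real_of_nat)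
  \<comment> \<open>There are (2 N + 1)^d cells, each contributing at most a constant times (K /
    N)^d. Estimating 2 N + 1 by 3 N cancels N, so the bound is independent of \<delta> and passes to
    the supremum.\<close>
  also have "\<dots> \<le> ennreal (?h * (3 * K) ^ ?d)"
  proof (rule ennreal_leI)
    have "real (card J) = (2 * real N + 1) ^ ?d" unfolding cardJ of_nat_power by (simp add: add.commute)
    also have "\<dots> \<le> (3 * real N) ^ ?d" using N0 by (intro power_mono) auto
    finally have "real (card J) \<le> (3 * real N) ^ ?d" .
    then have "card J * (?h * (K / N) ^ ?d) \<le> (3 * real N) ^ ?d * (?h * (K / N) ^ ?d)"
      using KN hausdorff_const_nonneg[of ?d] by (intro mult_right_mono) auto
    also have "\<dots> = ?h * (3 * K) ^ ?d"
      using N0 by (simp add: power_mult_distrib power_divide)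
    finally show "card J * (?h * (K / N) ^ ?d) \<le> ?h * (3 * K) ^ ?d" .
  qed
  finally show "hausdorff_pre (real ?d) \<delta> X \<le> ennreal (?h * (3 * (L * ?d * R)) ^ ?d)"
    by (simp add: K_def)
qed

text \<open>If y - x were inside the open ball of radius t \<epsilon> around t u, so would be y' - x
  for some y' in C - E close to y. That ball lies in C, so y' would belong to x + C and hence to
  E.\<close>

lemma effective_boundary_diff_notin_cone_ball:
  fixes C E :: "'a::euclidean_space set"
  assumes C: "pointed_cone_body C" and E: "pseudo_cone C E" and u: "ball u \<epsilon> \<subseteq> C"
    and x: "x \<in> effective_boundary C E" and y: "y \<in> effective_boundary C E"
    and t: "t > 0"
  shows "norm (y - x - t *\<^sub>R u) \<ge> t * \<epsilon>"
proof (rule ccontr)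
  assume less: "\<not> ?thesis"
  define \<eta> where "\<eta> = t * \<epsilon> - norm (y - x - t *\<^sub>R u)"
  have "\<eta> > 0" using less by (simp add: \<eta>_def)
  then obtain y' where y': "y' \<in> C - E" "dist y' y < \<eta>"
    using y closure_approachable[of y "C - E"] by (auto simp: effective_boundary_def)
  define w where "w = (1 / t) *\<^sub>R (y' - x)"
  have "norm (y' - x - t *\<^sub>R u) < t * \<epsilon>"
  proof -
    have "y' - x - t *\<^sub>R u = (y' - y) + (y - x - t *\<^sub>R u)" by simp
    then have "norm (y' - x - t *\<^sub>R u) \<le> norm (y' - y) + norm (y - x - t *\<^sub>R u)"
      by (metis norm_triangle_ineq)
    then show ?thesis using y'(2) by (simp add: \<eta>_def dist_norm)
  qed
  also have "y' - x - t *\<^sub>R u = t *\<^sub>R (w - u)" using t by (simp add: w_def scaleR_right_diff_distrib)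
  finally have "w \<in> ball u \<epsilon>" using t by (simp add: dist_norm norm_minus_commute)
  then have "t *\<^sub>R w \<in> C" using u t by (intro pointed_cone_body_scaleR[OF C]) auto
  then have "x + t *\<^sub>R w \<in> E" using x pseudo_cone_add[OF E] by (auto simp: effective_boundary_def)
  then show False using y' t by (simp add: w_def)
qed

text \<open>
  The effective boundary is a Lipschitz graph over a coordinate hyperplane, in a direction \<open>u\<close> from the
  interior of the cone.
\<close>
lemma hausdorff_outer_effective_boundary:
  fixes C E :: "'a::euclidean_space set"
  assumes dim: "DIM('a) \<ge> 2" and C: "pointed_cone_body C" and E: "pseudo_cone C E"
  obtains d where "d \<ge> 0"
    "\<And>R. R > 0 \<Longrightarrow> hausdorff_outer (real DIM('a) - 1) (effective_boundary C E \<inter> ball 0 R)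
        \<le> ennreal (d * R powr (real DIM('a) - 1))"
proof -
  have "interior C \<noteq> {}" using C by (auto simp: pointed_cone_body_def)
  then obtain u where u: "u \<in> interior C" by blast
  then obtain \<epsilon> where \<epsilon>: "\<epsilon> > 0" "ball u \<epsilon> \<subseteq> C" by (meson mem_interior)
  have u0: "u \<noteq> 0" using u pointed_cone_body_zero_notin_interior[OF C] by auto
  then obtain b where b: "b \<in> Basis" "u \<bullet> b \<noteq> 0"
    by (metis euclidean_all_zero_iff)
  define I where "I = Basis - {b}"
  define K where "K = 1 + norm u / \<bar>u \<bullet> b\<bar>"
  define L where "L = 1 + norm u / \<epsilon>"
  \<comment> \<open>The projection along u onto the hyperplane orthogonal to b. \<open>K\<close>
    bounds its operator norm, and \<open>L\<close> will be the Lipschitz constant of its inverse on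
    the effective boundary.\<close>
  define P where "P x = x - (x \<bullet> b / (u \<bullet> b)) *\<^sub>R u" for x
  have I: "finite I" "card I = DIM('a) - 1" "I \<noteq> {}"
  proof -
    show "card I = DIM('a) - 1" "finite I" using b by (auto simp: I_def card_Diff_singleton)
    then have "card I \<noteq> 0" using dim by simp
    then show "I \<noteq> {}" by auto
  qed
  have rI: "real (card I) = real DIM('a) - 1" using I dim by (simp add: of_nat_diff)
  have K: "K > 0" unfolding K_def by (simp add: add_pos_nonneg)
  have L: "L > 0" unfolding L_def using \<epsilon> by (simp add: add_pos_nonneg)
  have Pb: "P x \<bullet> b = 0" for x using b by (simp add: P_def inner_diff_left)
  have lin: "P (x - y) = P x - P y" for x y
    by (simp add: P_def inner_diff_left diff_divide_distrib scaleR_left_diff_distrib)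
  have normP: "norm (P x) \<le> K * norm x" for x
  proof -
    have "norm (P x) \<le> norm x + \<bar>x \<bullet> b\<bar> / \<bar>u \<bullet> b\<bar> * norm u"
      unfolding P_def using norm_triangle_ineq4[of x "(x \<bullet> b / (u \<bullet> b)) *\<^sub>R u"] by simp
    also have "\<dots> \<le> norm x + norm x / \<bar>u \<bullet> b\<bar> * norm u"
      using Basis_le_norm[OF b(1), of x] by (intro add_left_mono mult_right_mono divide_right_mono) auto
    finally show ?thesis by (simp add: K_def algebra_simps)
  qed
  have P1: "norm (P x) \<le> (\<Sum>i\<in>I. \<bar>P x \<bullet> i\<bar>)" for x
  proof -
    have "norm (P x) \<le> (\<Sum>i\<in>Basis. \<bar>P x \<bullet> i\<bar>)" by (rule norm_le_l1)
    also have "\<dots> = (\<Sum>i\<in>I. \<bar>P x \<bullet> i\<bar>)"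
      unfolding I_def using b Pb by (subst sum.remove[of _ b]) auto
    finally show ?thesis .
  qed
  \<comment> \<open>Write x - y as P (x - y) + t u with t >= 0. The preceding lemma gives t
    \<epsilon> <= |P (x - y)|, so the component along u is controlled by the projection. The other
    sign of t follows by exchanging x and y.\<close>
  have half: "norm (x - y) \<le> L * norm (P (x - y))"
    if xy: "x \<in> effective_boundary C E" "y \<in> effective_boundary C E"
      and t: "(x - y) \<bullet> b / (u \<bullet> b) \<ge> 0" for x y
  proof -
    define t where "t = (x - y) \<bullet> b / (u \<bullet> b)"
    have dec: "x - y = P (x - y) + t *\<^sub>R u" by (simp add: P_def t_def)
    have "t * \<epsilon> \<le> norm (P (x - y))"
    proof (cases "t = 0")
      case False
      then have "t > 0" using t unfolding t_def[symmetric] by simp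
      from effective_boundary_diff_notin_cone_ball[OF C E \<epsilon>(2) xy(2,1) this]
      show ?thesis by (simp add: P_def t_def)
    qed simp
    then have "t * norm u \<le> norm (P (x - y)) / \<epsilon> * norm u"
      using \<epsilon> by (intro mult_right_mono) (auto simp: field_simps)
    moreover have "norm (x - y) \<le> norm (P (x - y)) + t * norm u"
    proof -
      have "norm (x - y) = norm (P (x - y) + t *\<^sub>R u)" by (rule arg_cong[OF dec])
      also have "\<dots> \<le> norm (P (x - y)) + \<bar>t\<bar> * norm u"
        using norm_triangle_ineq[of "P (x - y)" "t *\<^sub>R u"] by simp
      also have "\<bar>t\<bar> = t" using t unfolding t_def[symmetric] by simp
      finally show ?thesis .
    qed
    ultimately show ?thesis by (simp add: L_def algebra_simps)
  qed
  have lip: "norm (x - y) \<le> L * norm (P x - P y)"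
    if xy: "x \<in> effective_boundary C E" "y \<in> effective_boundary C E" for x y
  proof (cases "(x - y) \<bullet> b / (u \<bullet> b) \<ge> 0")
    case True
    then show ?thesis using half[OF xy] lin by simp
  next
    case False
    then have "(y - x) \<bullet> b / (u \<bullet> b) \<ge> 0"
      by (metis inner_minus_left linorder_le_cases minus_diff_eq minus_divide_left neg_0_le_iff_le)
    then show ?thesis using half[OF xy(2,1)] lin[of y x] by (simp add: norm_minus_commute)
  qed
  define d where "d = hausdorff_const (real (card I)) * (3 * (L * card I * K)) ^ card I"
  show ?thesis
  proof (rule that[of d])
    show "d \<ge> 0" unfolding d_def using L K hausdorff_const_nonneg[of "card I"] by simp
    fix R :: real assume R: "R > 0"
    have "hausdorff_outer (real (card I)) (effective_boundary C E \<inter> ball 0 R)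
      \<le> ennreal (hausdorff_const (real (card I)) * (3 * (L * card I * (K * R))) ^ card I)"
    proof (rule hausdorff_outer_le_of_coordinates[where g = "\<lambda>i x. P x \<bullet> i"])
      show "\<bar>P x \<bullet> i\<bar> \<le> K * R" if "i \<in> I" "x \<in> effective_boundary C E \<inter> ball 0 R" for i x
      proof -
        have "\<bar>P x \<bullet> i\<bar> \<le> norm (P x)" using that(1) by (intro Basis_le_norm) (auto simp: I_def)
        also have "\<dots> \<le> K * norm x" by (rule normP)
        also have "\<dots> \<le> K * R" using that K by (intro mult_left_mono) auto
        finally show ?thesis .
      qed
      show "norm (x - y) \<le> L * (\<Sum>i\<in>I. \<bar>P x \<bullet> i - P y \<bullet> i\<bar>)"
        if "x \<in> effective_boundary C E \<inter> ball 0 R" "y \<in> effective_boundary C E \<inter> ball 0 R" for x y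
      proof -
        have "norm (x - y) \<le> L * norm (P (x - y))" using lip[of x y] that lin by simp
        also have "\<dots> \<le> L * (\<Sum>i\<in>I. \<bar>P (x - y) \<bullet> i\<bar>)" using L P1 by (intro mult_left_mono) auto
        finally show ?thesis by (simp add: lin inner_diff_left)
      qed
    qed (use I K L R in auto)
    also have "hausdorff_const (real (card I)) * (3 * (L * card I * (K * R))) ^ card I = d * R powr real (card I)"
      using R by (simp add: d_def powr_realpow power_mult_distrib mult_ac)
    finally show "hausdorff_outer (real DIM('a) - 1) (effective_boundary C E \<inter> ball 0 R)
        \<le> ennreal (d * R powr (real DIM('a) - 1))"
      unfolding rI .
  qed
qed

subsection \<open>Divergent integrals\<close>

lemma pointed_cone_body_interior_scaleR:
  assumes C: "pointed_cone_body C" and "u \<in> interior C" "s > 0"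
  shows "s *\<^sub>R u \<in> interior C"
proof -
  have "(*\<^sub>R) s ` interior C \<subseteq> C"
    using pointed_cone_body_scaleR[OF C] \<open>s > 0\<close> interior_subset[of C] by auto
  moreover have "open ((*\<^sub>R) s ` interior C)" using \<open>s > 0\<close> by (intro open_scaling) auto
  ultimately have "(*\<^sub>R) s ` interior C \<subseteq> interior C" by (rule interior_maximal)
  then show ?thesis using assms by auto
qed

lemma closed_ball_disjoint:
  assumes "closed S" "x \<notin> S"
  obtains r where "r > 0" "S \<inter> ball x r = {}"
  using assms by (metis ComplI Compl_disjoint disjoint_eq_subset_Compl inf_commute open_Compl open_contains_ball)

lemma cone_punctured_ball_infinite:
  fixes C :: "'a::euclidean_space set" and f :: "'a \<Rightarrow> real"
  assumes C: "pointed_cone_body C" and pos: "\<forall>x\<in>C - {0}. f x > 0"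
    and cont: "continuous_on (C - {0}) f"
    and hom: "\<forall>x\<in>C - {0}. \<forall>t>0. f (t *\<^sub>R x) = t powr (- q) * f x"
    and "q \<ge> real DIM('a)" and r: "r > 0"
  shows "(\<integral>\<^sup>+x. indicator (C \<inter> ball 0 r - {0}) x * ennreal (f x) \<partial>lborel) = \<infinity>"
proof (rule nn_integral_self_similar_infinite[where c = "1 / 2" and q = q
      and U = "interior C \<inter> (ball 0 r - cball 0 (r / 2))"])
  let ?S = "C \<inter> ball 0 r - {0}" and ?U = "interior C \<inter> (ball 0 r - cball 0 (r / 2))"
  show "(\<lambda>x. (1 / 2) *\<^sub>R x) ` ?S \<subseteq> ?S"
    using pointed_cone_body_scaleR[OF C, of "1 / 2"] r by auto
  show S: "?S \<in> sets borel" using pointed_cone_body_closed[OF C] by auto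
  show "(\<lambda>x. indicator ?S x * f x) \<in> borel_measurable borel"
    using borel_measurable_continuous_on_indicator[OF S continuous_on_subset[OF cont]] by auto
  have "(1 / 2) powr (real DIM('a) - q) = 2 powr (q - real DIM('a))"
    by (simp add: powr_divide powr_diff)
  then show "(1 / 2) powr (real DIM('a) - q) \<ge> 1" using assms by (simp add: ge_one_powr_ge_zero)
  show "open ?U" by auto
  show "?U \<subseteq> ?S" using interior_subset[of C] r by auto
  show "?U \<noteq> {}"
  proof -
    obtain u where u: "u \<in> interior C" using C by (auto simp: pointed_cone_body_def)
    then have u0: "u \<noteq> 0" using pointed_cone_body_zero_notin_interior[OF C] by auto
    \<comment> \<open>The multiple of u with norm 3 r / 4, strictly between the radii r / 2 and
      r.\<close>
    have "(3 * r / (4 * norm u)) *\<^sub>R u \<in> ?U"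
      using u u0 r by (auto intro!: pointed_cone_body_interior_scaleR[OF C])
    then show ?thesis by blast
  qed
  show "?U \<inter> (\<lambda>x. (1 / 2) *\<^sub>R x) ` ?S = {}" by auto
qed (use pos hom in auto)

lemma pseudo_cone_infinite:
  fixes C :: "'a::euclidean_space set" and f :: "'a \<Rightarrow> real"
  assumes C: "pointed_cone_body C" and pos: "\<forall>x\<in>C - {0}. f x > 0"
    and cont: "continuous_on (C - {0}) f"
    and hom: "\<forall>x\<in>C - {0}. \<forall>t>0. f (t *\<^sub>R x) = t powr (- q) * f x"
    and "q \<le> real DIM('a)" and E: "pseudo_cone C E"
  shows "(\<integral>\<^sup>+x. indicator E x * ennreal (f x) \<partial>lborel) = \<infinity>"
proof (rule nn_integral_self_similar_infinite[where c = 2 and q = q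
      and U = "interior E - (\<lambda>x. 2 *\<^sub>R x) ` E"])
  note E' = E[unfolded pseudo_cone_def]
  have EC: "E \<subseteq> C - {0}" using pseudo_cone_subset[OF E] E' by auto
  show "(\<lambda>x. 2 *\<^sub>R x) ` E \<subseteq> E" using E' by auto
  show S: "E \<in> sets borel" using E' by auto
  show "(\<lambda>x. indicator E x * f x) \<in> borel_measurable borel"
    using borel_measurable_continuous_on_indicator[OF S continuous_on_subset[OF cont EC]] by auto
  show "2 powr (real DIM('a) - q) \<ge> 1" using assms by (simp add: ge_one_powr_ge_zero)
  have "closed ((\<lambda>x. 2 *\<^sub>R x) ` E)" using E' by (intro closed_scaling) auto
  then show "open (interior E - (\<lambda>x. 2 *\<^sub>R x) ` E)" by auto
  \<comment> \<open>Otherwise the interior of E would be closed under halving. Repeated halving of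
    an interior point e + u converges to the origin, which would then lie in the closed set
    E.\<close>
  show "interior E - (\<lambda>x. 2 *\<^sub>R x) ` E \<noteq> {}"
  proof
    assume "interior E - (\<lambda>x. 2 *\<^sub>R x) ` E = {}"
    then have "(\<lambda>x. (1 / 2) *\<^sub>R x) ` interior E \<subseteq> E" by fastforce
    moreover have "open ((\<lambda>x. (1 / 2) *\<^sub>R x) ` interior E)" by (intro open_scaling) auto
    ultimately have half: "(\<lambda>x. (1 / 2) *\<^sub>R x) ` interior E \<subseteq> interior E" by (rule interior_maximal)
    obtain e u where e: "e \<in> E" and u: "u \<in> interior C"
      using E' C by (auto simp: pointed_cone_body_def)
    have "(+) e ` interior C \<subseteq> E"
      using pseudo_cone_add[OF E e] interior_subset[of C] by auto
    moreover have "open ((+) e ` interior C)" by (simp add: open_translation)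
    ultimately have x: "e + u \<in> interior E" using u interior_maximal by blast
    have iter: "(1 / 2) ^ k *\<^sub>R (e + u) \<in> interior E" for k
    proof (induction k)
      case (Suc k)
      then have "(1 / 2) *\<^sub>R ((1 / 2) ^ k *\<^sub>R (e + u)) \<in> interior E" using half by blast
      then show ?case by simp
    qed (use x in simp)
    have "(\<lambda>k. (1 / 2) ^ k *\<^sub>R (e + u)) \<longlonglongrightarrow> 0 *\<^sub>R (e + u)"
      by (intro tendsto_intros LIMSEQ_power_zero) auto
    moreover have "(1 / 2) ^ k *\<^sub>R (e + u) \<in> E" for k
      using iter interior_subset by blast
    ultimately have "0 *\<^sub>R (e + u) \<in> E" using E' by (meson closed_sequentially)
    then show False using E' by simp
  qed
  show "f (2 *\<^sub>R x) = 2 powr (- q) * f x" if "x \<in> E" for x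
    using hom subsetD[OF EC that] zero_less_numeral by blast
  show "f x > 0" if "x \<in> E" for x using pos EC that by auto
qed (use interior_subset in auto)

section \<open>Convergence and divergence according to the degree of homogeneity\<close>

theorem theorem1p2:
  fixes C E A :: "'a::euclidean_space set" and \<Theta> :: "'a \<Rightarrow> real" and q :: real and z :: 'a
  assumes dim: "DIM('a) \<ge> 2"
    and C: "pointed_cone_body C"
    and Theta_pos: "\<forall>x\<in>C - {0}. \<Theta> x > 0"
    and Theta_cont: "continuous_on (C - {0}) \<Theta>"
    and Theta_hom: "\<forall>x\<in>C - {0}. \<forall>t>0. \<Theta> (t *\<^sub>R x) = t powr (- q) * \<Theta> x"
    and E: "pseudo_cone C E"
    and A: "asymptotic_set C A"
    and z: "z \<in> C - {0}"
  shows
    "(q > real DIM('a) \<longrightarrow>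
        weighted_surface_mass C \<Theta> E < \<infinity> \<and> weighted_volume \<Theta> E < \<infinity> \<and>
        weighted_covolume C \<Theta> E = \<infinity> \<and> asymptotic_covolume C \<Theta> A 0 = \<infinity> \<and>
        asymptotic_covolume C \<Theta> A z < \<infinity>)
   \<and> (q = real DIM('a) \<longrightarrow>
        weighted_surface_mass C \<Theta> E < \<infinity> \<and> weighted_volume \<Theta> E = \<infinity> \<and>
        weighted_covolume C \<Theta> E = \<infinity> \<and> asymptotic_covolume C \<Theta> A 0 = \<infinity> \<and>
        asymptotic_covolume C \<Theta> A z < \<infinity>)
   \<and> (real DIM('a) - 1 < q \<and> q < real DIM('a) \<longrightarrow>
        weighted_surface_mass C \<Theta> E < \<infinity> \<and> weighted_volume \<Theta> E = \<infinity> \<and>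
        weighted_covolume C \<Theta> E < \<infinity> \<and> asymptotic_covolume C \<Theta> A 0 < \<infinity> \<and>
        asymptotic_covolume C \<Theta> A z < \<infinity>)
   \<and> (0 \<le> q \<and> q \<le> real DIM('a) - 1 \<longrightarrow> weighted_volume \<Theta> E = \<infinity>)"
proof -
  let ?n = "real DIM('a)"
  have n: "?n \<ge> 2" using dim by simp
  have clC: "closed C" by (rule pointed_cone_body_closed[OF C])
  have EC: "E \<subseteq> C" by (rule pseudo_cone_subset[OF E])
  have clE: "closed E" and E0: "0 \<notin> E" and "E \<noteq> {}" using E by (auto simp: pseudo_cone_def)
  then obtain e where e: "e \<in> E" by blast
  obtain r where r: "r > 0" "E \<inter> ball 0 r = {}" using closed_ball_disjoint[OF clE E0] by blast
  have clA: "closed A" and A0: "0 \<notin> A" using A by (auto simp: asymptotic_set_def)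
  obtain \<rho> where \<rho>: "\<rho> > 0" "A \<inter> ball 0 \<rho> = {}" using closed_ball_disjoint[OF clA A0] by blast
  obtain a where a: "a \<in> C" "(+) a ` C \<subseteq> A" using asymptotic_set_contains_translate[OF C A] by blast
  obtain c where c: "c \<ge> 0" "\<And>x. x \<in> C - {0} \<Longrightarrow> \<Theta> x \<le> c * norm x powr (- q)"
    using homogeneous_upper_bound[OF C Theta_cont Theta_hom] by blast

  \<comment> \<open>With a ball around the origin removed, only the growth exponent n - 1 of the
    strip matters. The statement therefore covers every q > n - 1, including q >= n.\<close>
  have strip_far: "(\<integral>\<^sup>+x. indicator (C - (+) y ` C - ball 0 s) x * ennreal (\<Theta> x) \<partial>lborel) < \<infinity>"
    if y: "y \<in> C" and s: "s > 0" and q: "q > ?n - 1" for y s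
  proof -
    have cl: "closed ((+) y ` C)" using clC by (rule closed_translation)
    obtain d where d: "d \<ge> 0"
      "\<And>R. R > 0 \<Longrightarrow> emeasure lborel ((C - (+) y ` C) \<inter> ball 0 R) \<le> ennreal (d * R powr (?n - 1))"
      using emeasure_cone_strip[OF C y] by blast
    show ?thesis
    proof (rule nn_integral_far_finite[where c = c and d = d and m = "?n - 1" and q = q and r = s])
      show "C - (+) y ` C - ball 0 s \<in> sets borel" using clC cl by auto
      show "\<Theta> x \<le> c * norm x powr (- q)" if "x \<in> C - (+) y ` C - ball 0 s" for x
        using that s by (intro c) auto
      show "emeasure lborel ((C - (+) y ` C - ball 0 s) \<inter> ball 0 R) \<le> ennreal (d * R powr (?n - 1))"
        if "R > 0" for R
      proof (rule order_trans[OF emeasure_mono d(2)[OF that]])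
        show "(C - (+) y ` C) \<inter> ball 0 R \<in> sets lborel" using clC cl by auto
      qed auto
    qed (use s c d q n in auto)
  qed
  have strip: "(\<integral>\<^sup>+x. indicator (C - (+) y ` C) x * ennreal (\<Theta> x) \<partial>lborel) < \<infinity>"
    if y: "y \<in> C" and q: "q > ?n - 1" "q < ?n" for y
  proof -
    let ?B = "ball (0::'a) 1" and ?T = "C - (+) y ` C"
    let ?f = "\<lambda>S x. indicator S x * ennreal (\<Theta> x)"
    have T: "?T \<in> sets borel" using clC closed_translation[OF clC, of y] by auto
    \<comment> \<open>Splitting the integral into a near and a far part requires measurable
      integrands. The weight is continuous only away from the origin, so the origin is removed
      first.\<close>
    have meas: "?f S \<in> borel_measurable lborel" if "S \<in> sets borel" "S \<subseteq> C - {0}" for S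
    proof -
      have "(\<lambda>x. ennreal (indicator S x *\<^sub>R \<Theta> x)) \<in> borel_measurable borel"
        using borel_measurable_continuous_on_indicator[OF that(1) continuous_on_subset[OF Theta_cont that(2)]]
        by measurable
      also have "(\<lambda>x. ennreal (indicator S x *\<^sub>R \<Theta> x)) = ?f S" by (auto simp: indicator_def)
      finally show ?thesis by simp
    qed
    have near: "(\<integral>\<^sup>+x. ?f (?T \<inter> ?B - {0}) x \<partial>lborel) < \<infinity>"
      using c q n by (intro nn_integral_near_finite[where c = c and q = q and r = 1]) auto
    have "(\<integral>\<^sup>+x. ?f ?T x \<partial>lborel) = (\<integral>\<^sup>+x. ?f (?T - {0}) x \<partial>lborel)"
      by (rule nn_integral_indicator_Diff_singleton[symmetric])
    also have "\<dots> = (\<integral>\<^sup>+x. ?f (?T - ?B) x + ?f (?T \<inter> ?B - {0}) x \<partial>lborel)"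
      by (intro nn_integral_cong) (auto simp: indicator_def)
    also have "\<dots> = (\<integral>\<^sup>+x. ?f (?T - ?B) x \<partial>lborel) + (\<integral>\<^sup>+x. ?f (?T \<inter> ?B - {0}) x \<partial>lborel)"
      using T by (intro nn_integral_add meas) auto
    also have "\<dots> < \<infinity>"
      using near strip_far[OF y zero_less_one q(1)] by (simp only: infinity_ennreal_def ennreal_add_less_top)
    finally show ?thesis .
  qed

  have surface: "weighted_surface_mass C \<Theta> E < \<infinity>" if q: "q > ?n - 1"
  proof -
    obtain d where d: "d \<ge> 0"
      "\<And>R. R > 0 \<Longrightarrow> hausdorff_outer (?n - 1) (effective_boundary C E \<inter> ball 0 R) \<le> ennreal (d * R powr (?n - 1))"
      using hausdorff_outer_effective_boundary[OF dim C E] by blast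
    show ?thesis unfolding weighted_surface_mass_def
    proof (rule nn_integral_far_finite[where c = c and d = d and m = "?n - 1" and q = q and r = r])
      show "effective_boundary C E \<in> sets borel" using clE by (auto simp: effective_boundary_def)
      show "effective_boundary C E \<inter> ball 0 r = {}" using r by (auto simp: effective_boundary_def)
      show "\<Theta> x \<le> c * norm x powr (- q)" if "x \<in> effective_boundary C E" for x
        using that EC E0 by (intro c) (auto simp: effective_boundary_def)
      show "emeasure (hausdorff_measure (?n - 1)) (effective_boundary C E \<inter> ball 0 R) \<le> ennreal (d * R powr (?n - 1))"
        if "R > 0" for R
        using emeasure_hausdorff_measure_le d(2)[OF that] by (rule order_trans)
    qed (use r c d q n in \<open>simp_all add: sets_hausdorff_measure\<close>)
  qed
  have volume: "weighted_volume \<Theta> E < \<infinity>" if q: "q > ?n"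
    unfolding weighted_volume_def
  proof (rule nn_integral_far_finite[where c = c and d = "unit_ball_vol ?n" and m = ?n and q = q and r = r])
    show "\<Theta> x \<le> c * norm x powr (- q)" if "x \<in> E" for x
      using that EC E0 by (intro c) auto
    show "emeasure lborel (E \<inter> ball 0 R) \<le> ennreal (unit_ball_vol ?n * R powr ?n)" if "R > 0" for R
    proof -
      have "emeasure lborel (E \<inter> ball 0 R) \<le> emeasure lborel (ball (0::'a) R)" by (intro emeasure_mono) auto
      then show ?thesis using that by (simp add: emeasure_ball powr_realpow)
    qed
  qed (use clE r c q in auto)
  have volume_infinite: "weighted_volume \<Theta> E = \<infinity>" if "q \<le> ?n"
    unfolding weighted_volume_def
    using pseudo_cone_infinite[OF C Theta_pos Theta_cont Theta_hom that E] .
  have ball_infinite: "(\<integral>\<^sup>+x. indicator T x * ennreal (\<Theta> x) \<partial>lborel) = \<infinity>"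
    if q: "q \<ge> ?n" and s: "s > 0" and T: "C \<inter> ball 0 s - {0} \<subseteq> T" for s T
    using cone_punctured_ball_infinite[OF C Theta_pos Theta_cont Theta_hom q s]
      nn_integral_indicator_mono[OF T, of lborel \<Theta>] by (simp add: top_unique)
  have covolume_infinite: "weighted_covolume C \<Theta> E = \<infinity>" if "q \<ge> ?n"
    unfolding weighted_covolume_def using r by (intro ball_infinite[OF that, of r]) auto
  have asym_infinite: "asymptotic_covolume C \<Theta> A 0 = \<infinity>" if "q \<ge> ?n"
    unfolding asymptotic_covolume_def using \<rho> by (intro ball_infinite[OF that, of \<rho>]) auto
  have covolume: "weighted_covolume C \<Theta> E < \<infinity>" if "q > ?n - 1" "q < ?n"
  proof -
    have "C - E \<subseteq> C - (+) e ` C" using pseudo_cone_add[OF E e] by auto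
    from nn_integral_indicator_mono[OF this, of lborel \<Theta>] show ?thesis
      unfolding weighted_covolume_def using strip[OF _ that, of e] e EC by (meson le_less_trans subsetD)
  qed
  have asym_zero: "asymptotic_covolume C \<Theta> A 0 < \<infinity>" if "q > ?n - 1" "q < ?n"
  proof -
    have "(+) 0 ` C - (+) 0 ` A \<subseteq> C - (+) a ` C" using a by auto
    from nn_integral_indicator_mono[OF this, of lborel \<Theta>] show ?thesis
      unfolding asymptotic_covolume_def using strip[OF a(1) that] by (meson le_less_trans)
  qed
  have asym: "asymptotic_covolume C \<Theta> A z < \<infinity>" if q: "q > ?n - 1"
  proof -
    \<comment> \<open>Pointedness keeps the closed set z + C away from a ball around the origin.
      Hence the far estimate alone suffices for z, whereas the co-volume at the origin diverges for
      q >= n.\<close>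
    have "0 \<notin> (+) z ` C"
    proof
      assume "0 \<in> (+) z ` C"
      then obtain x where "x \<in> C" "0 = z + x" by blast
      then have "- z \<in> C" by (metis add_eq_0_iff)
      then show False using z pointed_cone_body_pointed[OF C, of z] by auto
    qed
    then obtain s where s: "s > 0" "(+) z ` C \<inter> ball 0 s = {}"
      using closed_ball_disjoint[OF closed_translation[OF clC]] by metis
    have za: "z + a \<in> C" using z a by (intro pointed_cone_body_add[OF C]) auto
    \<comment> \<open>As a + C lies in A, its translate z + a + C lies in z + A, and z + C lies in
      C. So the region is part of the strip for the vector z + a.\<close>
    have "(+) z ` C - (+) z ` A \<subseteq> C - (+) (z + a) ` C - ball 0 s"
    proof
      fix y assume "y \<in> (+) z ` C - (+) z ` A"
      then obtain x where x: "y = z + x" "x \<in> C" "x \<notin> A" by auto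
      have "y \<notin> (+) (z + a) ` C" using x a by (auto simp: add.assoc)
      moreover have "y \<notin> ball 0 s" using x s by blast
      moreover have "y \<in> C" using x z by (auto intro: pointed_cone_body_add[OF C])
      ultimately show "y \<in> C - (+) (z + a) ` C - ball 0 s" by blast
    qed
    from nn_integral_indicator_mono[OF this, of lborel \<Theta>] show ?thesis
      unfolding asymptotic_covolume_def using strip_far[OF za s(1) q] by (meson le_less_trans)
  qed
  show ?thesis
    using surface volume volume_infinite covolume_infinite asym_infinite covolume asym_zero asym n
    by (intro conjI impI) auto
qed

end
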